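(* Let $G(x)=\sum_{n\ge0}a_nx^n$ be a formal power series with integer coefficients, $a_0=1$, such that $(a_n)_n$ satisfies the Lucas property. If $G'/G$ is algebraic over $\mathbb Q(x)$, then $G'/G$ is a rational function over $\mathbb Q$, i.e. $G'/G\in\mathbb Q(x)$.
   Context: An integer sequence $(u_n)_{n\ge0}$ has the Lucas property if for all sufficiently large primes $p$, $u_{np+q}\equiv u_nu_q\pmod p$ for all $n\ge0$ and $0\le q\le p-1$. $G'$ denotes the formal derivative. *)

theory Defs
  imports
    "HOL-Computational_Algebra.Computational_Algebra"
    "HOL-Number_Theory.Cong"
begin

definition lucas_property :: "(nat \<Rightarrow> int) \<Rightarrow> bool" where
  "lucas_property u \<longleftrightarrow>
     (\<exists>N. \<forall>p::nat. prime p \<and> p > N \<longrightarrow>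
        (\<forall>n q. q < p \<longrightarrow> [u (n * p + q) = u n * u q] (mod int p)))"

text \<open>An integer power series, regarded as an element of the field of Laurent series over
  the rationals.\<close>

definition fls_of_int_fps :: "int fps \<Rightarrow> rat fls" where
  "fls_of_int_fps G = fps_to_fls (Abs_fps (\<lambda>n. rat_of_int (fps_nth G n)))"

text \<open>The field of rational functions over a field, as a subfield of the field of formal
  Laurent series: a rational function is identified with its Laurent expansion at 0.\<close>

definition rational_functions :: "'a::field fls set" where
  "rational_functions =
     {fps_to_fls (fps_of_poly p) / fps_to_fls (fps_of_poly q) | p q. q \<noteq> 0}"

text \<open>Same shape as the library's \<^const>\<open>algebraic\<close>, but with the coefficients ranging over an
  arbitrary subset \<open>K\<close> (meant to be a subfield) instead of the integers.\<close>

definition algebraic_over :: "'a::field set \<Rightarrow> 'a \<Rightarrow> bool" where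
  "algebraic_over K x \<longleftrightarrow> (\<exists>P. (\<forall>i. coeff P i \<in> K) \<and> P \<noteq> 0 \<and> poly P x = 0)"

end

theory Submission
  imports Defs
begin

text \<open>
  Write \<open>a\<^sub>n\<close> for the coefficients of \<open>G\<close>, and \<open>f = G' / G\<close>, a power series with integer
  coefficients because \<open>a\<^sub>0 = 1\<close>. The proof compares two descriptions of \<open>f\<close> modulo a large
  prime \<open>p\<close>.

  On one side, the Lucas property says that \<open>G(x) \<equiv> A(x) G(x\<^sup>p)\<close> modulo \<open>p\<close>, where \<open>A\<close> is the
  truncation of \<open>G\<close> to degree less than \<open>p\<close>. The derivative of \<open>G(x\<^sup>p)\<close> vanishes modulo \<open>p\<close>, so
  \<open>f \<equiv> A' / A\<close>: the reduction of \<open>f\<close> is a rational function, although of a degree that grows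
  with \<open>p\<close> (\<open>lucas_log_deriv_rational_mod\<close>).

  On the other side, an algebraic equation for \<open>f\<close> over \<open>\<int>[x]\<close> with leading coefficient \<open>c\<close>
  makes \<open>h = c f\<close> integral over \<open>\<int>[x]\<close> (\<open>integral_leading_coeff_mult\<close>). The reduction of \<open>h\<close>
  is thus rational and integral over the polynomials, hence a polynomial
  (\<open>associate_polynomial_mod_of_common_denominator\<close>); and comparing leading terms in the
  monic equation bounds its degree by the largest degree \<open>B\<close> of the coefficients of that
  equation (\<open>integral_polynomial_mod_degree_bound\<close>). The point is that \<open>B\<close> does not depend
  on \<open>p\<close>. So each coefficient of \<open>h\<close> beyond \<open>x\<^sup>B\<close> is an integer divisible by all large primes
  and therefore zero, \<open>h\<close> is a polynomial, and \<open>f = h / c\<close> is rational.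

  Reduction modulo \<open>p\<close> is expressed throughout by divisibility by the constant \<open>p\<close> in the
  ring of power series, so that no residue field depending on \<open>p\<close> is involved.
\<close>

section \<open>Divisibility by a constant in power series rings\<close>

lemma fps_const_dvd_iff:
  fixes c :: "'a::comm_semiring_1"
  shows "fps_const c dvd f \<longleftrightarrow> (\<forall>n. c dvd fps_nth f n)"
proof
  assume "\<forall>n. c dvd fps_nth f n"
  then obtain g where "\<And>n. fps_nth f n = c * g n"
    unfolding dvd_def by metis
  then have "f = fps_const c * Abs_fps g"
    by (simp add: fps_eq_iff)
  then show "fps_const c dvd f" by simp
qed (auto elim!: dvdE)

text \<open>Gauss's lemma for power series. If neither factor were divisible by \<open>q\<close>, the lowest
  coefficients not divisible by \<open>q\<close> would multiply to such a coefficient of the product.\<close>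
lemma fps_const_prime_dvd_mult:
  fixes q :: "'a::idom"
  assumes q: "prime_elem q" and dvd: "fps_const q dvd f * g"
  shows "fps_const q dvd f \<or> fps_const q dvd g"
proof (rule ccontr)
  assume "\<not> ?thesis"
  then have ex: "\<exists>n. \<not> q dvd fps_nth f n" "\<exists>n. \<not> q dvd fps_nth g n"
    by (auto simp: fps_const_dvd_iff)
  define n where "n = (LEAST n. \<not> q dvd fps_nth f n)"
  define m where "m = (LEAST m. \<not> q dvd fps_nth g m)"
  have n: "\<not> q dvd fps_nth f n" "\<And>i. i < n \<Longrightarrow> q dvd fps_nth f i"
    using LeastI_ex[OF ex(1)] not_less_Least unfolding n_def by blast+
  have m: "\<not> q dvd fps_nth g m" "\<And>i. i < m \<Longrightarrow> q dvd fps_nth g i"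
    using LeastI_ex[OF ex(2)] not_less_Least unfolding m_def by blast+
  \<comment> \<open>In every other term of the convolution one index lies below \<open>n\<close> or \<open>m\<close>.\<close>
  have "fps_nth (f * g) (n + m) = fps_nth f n * fps_nth g m
      + (\<Sum>i\<in>{0..n+m} - {n}. fps_nth f i * fps_nth g (n + m - i))"
    by (simp add: fps_mult_nth sum.remove[of _ n])
  moreover have "q dvd (\<Sum>i\<in>{0..n+m} - {n}. fps_nth f i * fps_nth g (n + m - i))"
  proof (rule dvd_sum)
    fix i assume "i \<in> {0..n+m} - {n}"
    then have "i < n \<or> n + m - i < m" by auto
    then show "q dvd fps_nth f i * fps_nth g (n + m - i)"
      using n(2) m(2) by (meson dvd_mult dvd_mult2)
  qed
  moreover have "q dvd fps_nth (f * g) (n + m)"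
    using dvd by (simp add: fps_const_dvd_iff)
  ultimately have "q dvd fps_nth f n * fps_nth g m"
    by (simp add: dvd_add_left_iff)
  then show False
    using n(1) m(1) q by (simp add: prime_elem_dvd_mult_iff)
qed

lemma fps_const_dvd_fps_of_poly_iff:
  fixes c :: "'a::idom"
  shows "fps_const c dvd fps_of_poly u \<longleftrightarrow> [:c:] dvd u"
  by (simp add: fps_const_dvd_iff const_poly_dvd_iff)

section \<open>Power series that are polynomials modulo a constant\<close>

definition polynomial_mod :: "'a::comm_ring_1 \<Rightarrow> 'a fps \<Rightarrow> bool" where
  "polynomial_mod q f \<longleftrightarrow> (\<exists>u. fps_const q dvd f - fps_of_poly u)"

lemma polynomial_mod_fps_of_poly: "polynomial_mod q (fps_of_poly u)"
  unfolding polynomial_mod_def by (rule exI[of _ u]) simp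

lemma polynomial_mod_dvd: "fps_const q dvd f \<Longrightarrow> polynomial_mod q f"
  unfolding polynomial_mod_def by (rule exI[of _ 0]) simp

lemma polynomial_mod_add:
  assumes "polynomial_mod q f" "polynomial_mod q g"
  shows "polynomial_mod q (f + g)"
proof -
  from assms obtain u v where "fps_const q dvd f - fps_of_poly u" "fps_const q dvd g - fps_of_poly v"
    unfolding polynomial_mod_def by blast
  then have "fps_const q dvd (f - fps_of_poly u) + (g - fps_of_poly v)" by (rule dvd_add)
  then have "fps_const q dvd (f + g) - fps_of_poly (u + v)"
    by (simp add: fps_of_poly_add algebra_simps)
  then show ?thesis unfolding polynomial_mod_def by blast
qed

lemma polynomial_mod_mult:
  assumes "polynomial_mod q f" "polynomial_mod q g"
  shows "polynomial_mod q (f * g)"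
proof -
  from assms obtain u v where "fps_const q dvd f - fps_of_poly u" "fps_const q dvd g - fps_of_poly v"
    unfolding polynomial_mod_def by blast
  then have "fps_const q dvd (f - fps_of_poly u) * g + fps_of_poly u * (g - fps_of_poly v)" by simp
  then have "fps_const q dvd (f * g) - fps_of_poly (u * v)"
    by (simp add: fps_of_poly_mult algebra_simps)
  then show ?thesis unfolding polynomial_mod_def by blast
qed

lemma polynomial_mod_minus:
  assumes "polynomial_mod q f" "polynomial_mod q g"
  shows "polynomial_mod q (f - g)"
  using polynomial_mod_add[OF assms(1) polynomial_mod_mult[OF polynomial_mod_fps_of_poly[of q "- 1"] assms(2)]]
  by (simp add: fps_of_poly_uminus)

lemma polynomial_mod_power: "polynomial_mod q f \<Longrightarrow> polynomial_mod q (f ^ n)"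
proof (induction n)
  case 0
  show ?case using polynomial_mod_fps_of_poly[of q 1] by simp
qed (simp add: polynomial_mod_mult)

lemma polynomial_mod_sum:
  "(\<And>i. i \<in> A \<Longrightarrow> polynomial_mod q (f i)) \<Longrightarrow> polynomial_mod q (sum f A)"
  by (induction A rule: infinite_finite_induct)
     (auto intro: polynomial_mod_add polynomial_mod_dvd)

section \<open>Integral power series that are rational modulo a prime\<close>

text \<open>A monic equation of degree \<open>d\<close> expresses every power of \<open>h\<close> by those below \<open>h\<^sup>d\<close>, so
  one power of the denominator \<open>v\<close> of \<open>h\<close> serves all powers of \<open>h\<close> at once.\<close>
lemma common_denominator_of_powers:
  assumes rel: "h ^ d = (\<Sum>j<d. fps_of_poly (b j) * h ^ j)"
    and v: "polynomial_mod q (fps_of_poly v * h)"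
  shows "polynomial_mod q (fps_of_poly (v ^ d) * h ^ i)"
proof (induction i rule: less_induct)
  case (less i)
  show ?case
  proof (cases "i < d")
    case True
    have "fps_of_poly (v ^ d) * h ^ i = fps_of_poly (v ^ (d - i)) * (fps_of_poly v * h) ^ i"
    proof -
      have "v ^ d = v ^ (d - i) * v ^ i"
        using True by (simp flip: power_add)
      then show ?thesis
        by (simp only: fps_of_poly_mult fps_of_poly_power power_mult_distrib mult.assoc)
    qed
    moreover have "polynomial_mod q \<dots>"
      by (intro polynomial_mod_mult polynomial_mod_power polynomial_mod_fps_of_poly v)
    ultimately show ?thesis by (simp only:)
  next
    case False
    have "h ^ i = h ^ d * h ^ (i - d)"
      using False by (simp flip: power_add)
    then have "fps_of_poly (v ^ d) * h ^ i
        = (\<Sum>j<d. fps_of_poly (b j) * (fps_of_poly (v ^ d) * h ^ (j + (i - d))))"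
      by (simp add: rel sum_distrib_left sum_distrib_right power_add mult_ac)
    moreover have "polynomial_mod q (fps_of_poly (v ^ d) * h ^ (j + (i - d)))" if "j < d" for j
      using that False by (intro less.IH) simp
    then have "polynomial_mod q
        (\<Sum>j<d. fps_of_poly (b j) * (fps_of_poly (v ^ d) * h ^ (j + (i - d))))"
      by (blast intro: polynomial_mod_sum polynomial_mod_mult polynomial_mod_fps_of_poly)
    ultimately show ?thesis by (simp only:)
  qed
qed

text \<open>
  This is complete integral closedness of a polynomial ring over a field, with the residue
  field replaced by pseudo-division over the base domain; the multiplier \<open>a\<close>, nonzero
  modulo \<open>q\<close>, is the price of that. The common denominators of all
  powers of \<open>h\<close> form an ideal. If \<open>w\<close> is one of minimal degree among those that are nonzero
  modulo \<open>q\<close>, then \<open>w h\<close> is congruent to another member \<open>w\<^sub>1\<close> of the ideal; division by \<open>w\<close>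
  leaves a remainder that is zero modulo \<open>q\<close>, so \<open>w\<close> divides \<open>w h\<close> in the polynomials modulo
  \<open>q\<close>, up to \<open>a\<close>, and \<open>w\<close> can be cancelled.
\<close>
lemma associate_polynomial_mod_of_common_denominator:
  fixes q :: "'a::idom"
  assumes q: "prime_elem q" and w0: "\<not> [:q:] dvd w0"
    and den: "\<And>i. polynomial_mod q (fps_of_poly w0 * h ^ i)"
  shows "\<exists>a. \<not> q dvd a \<and> polynomial_mod q (fps_const a * h)"
proof -
  define denominators where "denominators = {w. \<forall>i. polynomial_mod q (fps_of_poly w * h ^ i)}"
  have den_diff: "u - v \<in> denominators" if "u \<in> denominators" "v \<in> denominators" for u v
    using that by (auto simp: denominators_def fps_of_poly_diff left_diff_distrib
        intro: polynomial_mod_minus)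
  have den_mult: "u * v \<in> denominators" if "v \<in> denominators" for u v
    using that by (auto simp: denominators_def fps_of_poly_mult mult.assoc
        intro: polynomial_mod_mult polynomial_mod_fps_of_poly)
  have den_dvd: "u \<in> denominators" if "[:q:] dvd u" for u
    using that by (auto simp: denominators_def fps_const_dvd_fps_of_poly_iff
        intro: polynomial_mod_dvd dvd_mult2)
  define P where "P = (\<lambda>w. w \<in> denominators \<and> \<not> [:q:] dvd w)"
  have "P w0" using w0 den by (simp add: P_def denominators_def)
  then obtain w where w: "P w" and min: "\<And>u. P u \<Longrightarrow> degree w \<le> degree u"
    using ex_has_least_nat[of P w0 degree] by blast
  have wD: "w \<in> denominators" and wq: "\<not> [:q:] dvd w" using w by (simp_all add: P_def)
  \<comment> \<open>Otherwise dropping the leading term would give a denominator of smaller degree.\<close>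
  have lc: "\<not> q dvd lead_coeff w"
  proof
    assume lc: "q dvd lead_coeff w"
    define m where "m = monom (lead_coeff w) (degree w)"
    have m: "[:q:] dvd m" using lc by (simp add: m_def const_poly_dvd_iff)
    then have "P (w - m)"
      using wD wq den_diff den_dvd by (simp add: P_def dvd_diff_left_iff)
    have "w - m \<noteq> 0" using m wq by auto
    moreover have "degree (w - m) \<le> degree w"
      by (rule degree_diff_le) (simp_all add: m_def degree_monom_le)
    moreover have "coeff (w - m) (degree w) = 0" by (simp add: m_def)
    ultimately have "degree (w - m) < degree w"
      by (metis le_neq_implies_less leading_coeff_0_iff)
    then show False using min[OF \<open>P (w - m)\<close>] by simp
  qed
  have "polynomial_mod q (fps_of_poly w * h)"
    using wD by (auto simp: denominators_def dest: spec[of _ 1])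
  then obtain w1 where w1: "fps_const q dvd fps_of_poly w * h - fps_of_poly w1"
    unfolding polynomial_mod_def by blast
  have "w1 \<in> denominators"
    unfolding denominators_def
  proof safe
    fix i
    have "fps_of_poly w1 * h ^ i = fps_of_poly w * h ^ Suc i
        - (fps_of_poly w * h - fps_of_poly w1) * h ^ i"
      by (simp add: algebra_simps)
    moreover have "polynomial_mod q (fps_of_poly w * h ^ Suc i)"
      using wD unfolding denominators_def by blast
    moreover have "polynomial_mod q ((fps_of_poly w * h - fps_of_poly w1) * h ^ i)"
      using w1 by (intro polynomial_mod_dvd dvd_mult2)
    ultimately show "polynomial_mod q (fps_of_poly w1 * h ^ i)"
      by (simp only: polynomial_mod_minus)
  qed
  obtain s r where sr: "pseudo_divmod w1 w = (s, r)" by fastforce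
  have "w \<noteq> 0" using wq by auto
  define a where "a = lead_coeff w ^ (Suc (degree w1) - degree w)"
  have a: "smult a w1 = w * s + r" and r: "r = 0 \<or> degree r < degree w"
    using pseudo_divmod[OF \<open>w \<noteq> 0\<close> sr] by (simp_all add: a_def)
  have "r = [:a:] * w1 - s * w" using a by (simp add: algebra_simps)
  then have "r \<in> denominators"
    using den_diff den_mult \<open>w1 \<in> denominators\<close> wD by metis
  then have "[:q:] dvd r" using r min[of r] unfolding P_def by fastforce
  then have rq: "fps_const q dvd fps_of_poly r"
    by (simp add: fps_const_dvd_iff const_poly_dvd_iff)
  have "fps_of_poly w * (fps_const a * h - fps_of_poly s)
      = fps_const a * (fps_of_poly w * h - fps_of_poly w1) + fps_of_poly r"
    using arg_cong[OF a, of fps_of_poly]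
    by (simp add: fps_of_poly_mult fps_of_poly_add fps_of_poly_smult algebra_simps)
  then have "fps_const q dvd fps_of_poly w * (fps_const a * h - fps_of_poly s)"
    using rq w1 by simp
  moreover have "\<not> fps_const q dvd fps_of_poly w"
    using wq by (simp add: fps_const_dvd_iff const_poly_dvd_iff)
  ultimately have "fps_const q dvd fps_const a * h - fps_of_poly s"
    using fps_const_prime_dvd_mult[OF q] by blast
  moreover have "\<not> q dvd a"
    using lc q prime_elem_dvd_power unfolding a_def by blast
  ultimately show ?thesis unfolding polynomial_mod_def by blast
qed

text \<open>If \<open>h\<close> has degree \<open>m > B\<close> modulo \<open>q\<close>, then \<open>h\<^sup>d\<close> has degree \<open>d m\<close>, while every other term of
  the monic equation has degree at most \<open>B + (d - 1) m < d m\<close>. The hypothesis on \<open>N\<close> says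
  that \<open>h\<close> is a polynomial modulo \<open>q\<close>, of whatever degree.\<close>
lemma integral_polynomial_mod_degree_bound:
  fixes q :: "'a::idom"
  assumes q: "prime_elem q"
    and rel: "h ^ d = (\<Sum>j<d. fps_of_poly (b j) * h ^ j)"
    and B: "\<And>j. j < d \<Longrightarrow> degree (b j) \<le> B"
    and N: "\<And>n. n > N \<Longrightarrow> q dvd fps_nth h n"
    and n: "n > B"
  shows "q dvd fps_nth h n"
proof (rule ccontr)
  assume nq: "\<not> q dvd fps_nth h n"
  define S where "S = {n. \<not> q dvd fps_nth h n}"
  have "S \<subseteq> {..N}" using N by (auto simp: S_def not_less[symmetric])
  then have fin: "finite S" by (rule finite_subset) simp
  have "n \<in> S" using nq by (simp add: S_def)
  define m where "m = Max S"
  have mS: "m \<in> S" using fin \<open>n \<in> S\<close> unfolding m_def by (intro Max_in) auto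
  have "m > B" using Max_ge[OF fin \<open>n \<in> S\<close>] n by (simp add: m_def)
  have mq: "\<not> q dvd fps_nth h m" using mS by (simp add: S_def)
  have above: "q dvd fps_nth h i" if "i > m" for i
    using that Max_ge[OF fin, of i] by (auto simp: m_def S_def)
  \<comment> \<open>An honest polynomial congruent to \<open>h\<close> modulo \<open>q\<close>, so that degrees can be compared.\<close>
  define H where "H = truncate_fps (Suc m) h"
  have cH: "coeff H i = (if i \<le> m then fps_nth h i else 0)" for i
    using fps_of_poly_nth[of H i, symmetric] by (simp add: H_def less_Suc_eq_le)
  define E where "E = fps_of_poly H"
  have hE: "fps_const q dvd h - E"
    using above by (auto simp: fps_const_dvd_iff E_def cH)
  have hE_pow: "fps_const q dvd h ^ j - E ^ j" for j
    using hE by (auto simp: power_diff_sumr2 intro: dvd_mult2)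
  have "E ^ d - (\<Sum>j<d. fps_of_poly (b j) * E ^ j)
      = (\<Sum>j<d. fps_of_poly (b j) * (h ^ j - E ^ j)) - (h ^ d - E ^ d)"
    using rel by (simp add: right_diff_distrib sum_subtractf)
  also have "fps_const q dvd \<dots>"
    by (intro dvd_diff dvd_sum dvd_mult hE_pow)
  finally have "fps_const q dvd fps_of_poly (H ^ d - (\<Sum>j<d. b j * H ^ j))"
    by (simp add: E_def fps_of_poly_diff fps_of_poly_sum fps_of_poly_mult fps_of_poly_power)
  then have *: "q dvd coeff (H ^ d) (d * m) - (\<Sum>j<d. coeff (b j * H ^ j) (d * m))"
    by (simp add: fps_const_dvd_iff coeff_sum)
  have degH: "degree H = m"
  proof (rule antisym)
    show "degree H \<le> m" by (rule degree_le) (simp add: cH)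
    show "m \<le> degree H" using mq by (intro le_degree) (auto simp: cH)
  qed
  have "coeff (b j * H ^ j) (d * m) = 0" if "j < d" for j
  proof (rule coeff_eq_0)
    have "degree (b j * H ^ j) \<le> degree (b j) + degree (H ^ j)" by (rule degree_mult_le)
    also have "degree (H ^ j) \<le> m * j" using degree_power_le[of H j] degH by simp
    also have "degree (b j) + m * j < m + m * j" using B[OF that] \<open>m > B\<close> by simp
    also have "\<dots> = m * Suc j" by simp
    also have "\<dots> \<le> m * d" using that by (intro mult_le_mono2) simp
    finally show "degree (b j * H ^ j) < d * m" by (simp add: mult.commute)
  qed
  moreover have "coeff (H ^ d) (d * m) = fps_nth h m ^ d"
  proof -
    have "H \<noteq> 0" using mq by (auto simp: cH dest: arg_cong[of H 0 "\<lambda>p. coeff p m"] split: if_splits)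
    then have "degree (H ^ d) = d * m" by (simp add: degree_power_eq degH)
    then show ?thesis using lead_coeff_power[of H d] by (simp add: degH cH)
  qed
  ultimately have "q dvd fps_nth h m ^ d" using * by simp
  then show False using mq q prime_elem_dvd_power by blast
qed


lemma integral_rational_mod_degree_bound:
  fixes q :: "'a::idom"
  assumes q: "prime_elem q"
    and rel: "h ^ d = (\<Sum>j<d. fps_of_poly (b j) * h ^ j)"
    and B: "\<And>j. j < d \<Longrightarrow> degree (b j) \<le> B"
    and v: "\<not> [:q:] dvd v" "polynomial_mod q (fps_of_poly v * h)"
    and n: "n > B"
  shows "q dvd fps_nth h n"
proof -
  have "\<not> [:q:] dvd v ^ d"
    using v(1) q prime_elem_dvd_power prime_elem_const_poly_iff by blast
  then have "\<exists>a. \<not> q dvd a \<and> polynomial_mod q (fps_const a * h)"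
    using common_denominator_of_powers[OF rel v(2)]
    by (rule associate_polynomial_mod_of_common_denominator[OF q])
  then obtain a u where a: "\<not> q dvd a" and u: "fps_const q dvd fps_const a * h - fps_of_poly u"
    unfolding polynomial_mod_def by blast
  have "q dvd fps_nth h k" if "k > degree u" for k
  proof -
    have "q dvd a * fps_nth h k"
      using u that by (auto simp: fps_const_dvd_iff coeff_eq_0 dest: spec[of _ k])
    then show ?thesis using a q by (simp add: prime_elem_dvd_mult_iff)
  qed
  then show ?thesis
    using integral_polynomial_mod_degree_bound[OF q rel B _ n] by blast
qed

text \<open>Multiplying the equation of \<open>f\<close> by the power of its leading coefficient with exponent
  \<open>d - 1\<close> turns it into a monic equation for \<open>h\<close>. The case \<open>d = 0\<close> is void, since the
  equation would then say that its leading coefficient is zero.\<close>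
lemma integral_leading_coeff_mult:
  fixes f :: "'a::idom fps"
  assumes rel: "(\<Sum>i\<le>d. fps_of_poly (c i) * f ^ i) = 0" and nz: "c d \<noteq> 0"
  defines "h \<equiv> fps_of_poly (c d) * f"
  shows "h ^ d = (\<Sum>j<d. fps_of_poly (- (c j * c d ^ (d - Suc j))) * h ^ j)"
proof (cases d)
  case 0
  then show ?thesis using rel nz by (simp add: fps_of_poly_eq_iff[of _ 0, simplified])
next
  case (Suc e)
  have lower: "fps_of_poly (c d ^ e) * (fps_of_poly (c j) * f ^ j)
      = fps_of_poly (c j * c d ^ (d - Suc j)) * h ^ j" if "j < d" for j
  proof -
    have "c d ^ e = c d ^ (d - Suc j) * c d ^ j"
      using that Suc by (simp flip: power_add)
    then show ?thesis
      by (simp add: h_def fps_of_poly_mult fps_of_poly_power power_mult_distrib mult_ac)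
  qed
  have "0 = fps_of_poly (c d ^ e) * (\<Sum>i\<le>d. fps_of_poly (c i) * f ^ i)"
    using rel by simp
  also have "\<dots> = (\<Sum>j<d. fps_of_poly (c d ^ e) * (fps_of_poly (c j) * f ^ j))
      + fps_of_poly (c d ^ e) * (fps_of_poly (c d) * f ^ d)"
    by (simp add: sum_distrib_left distrib_left flip: lessThan_Suc_atMost)
  also have "fps_of_poly (c d ^ e) * (fps_of_poly (c d) * f ^ d) = h ^ d"
    by (simp add: h_def Suc fps_of_poly_power power_mult_distrib mult_ac)
  also have "(\<Sum>j<d. fps_of_poly (c d ^ e) * (fps_of_poly (c j) * f ^ j))
      = (\<Sum>j<d. fps_of_poly (c j * c d ^ (d - Suc j)) * h ^ j)"
    using lower by (intro sum.cong) auto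
  finally show ?thesis
    by (simp add: fps_of_poly_uminus sum_negf add_eq_0_iff)
qed

section \<open>The logarithmic derivative modulo a prime with the Lucas property\<close>

text \<open>With \<open>E = G(x\<^sup>p)\<close>, the Lucas property is the congruence \<open>G \<equiv> A E\<close>: since \<open>A\<close> has
  degree less than \<open>p\<close> and \<open>E\<close> contains only powers of \<open>x\<^sup>p\<close>, division with remainder by \<open>p\<close>
  picks a single term of each coefficient of \<open>A E\<close>. As \<open>E'\<close> vanishes modulo \<open>p\<close>, both
  products in the conclusion are congruent to \<open>A A' E\<close>.\<close>
lemma lucas_log_deriv_mod:
  fixes G :: "int fps" and p :: nat
  assumes p: "prime p"
    and lucas: "\<And>n r. r < p \<Longrightarrow>
      [fps_nth G (n * p + r) = fps_nth G n * fps_nth G r] (mod int p)"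
  defines "A \<equiv> fps_of_poly (truncate_fps p G)"
  shows "fps_const (int p) dvd fps_deriv G * A - G * fps_deriv A"
proof -
  define E where "E = Abs_fps (\<lambda>n. if p dvd n then fps_nth G (n div p) else 0)"
  have "p > 0" using p by (simp add: prime_gt_0_nat)
  have AE: "fps_nth (A * E) n = fps_nth G (n mod p) * fps_nth G (n div p)" for n
  proof -
    have zero: "fps_nth A i * fps_nth E (n - i) = 0" if "i \<in> {0..n} - {n mod p}" for i
    proof -
      have "i \<ge> p \<or> \<not> p dvd n - i"
      proof (rule ccontr)
        assume "\<not> ?thesis"
        then have "i < p" "p dvd n - i" by auto
        moreover have "i \<le> n" using that by simp
        ultimately have "n mod p = i"
          using mod_eq_dvd_iff_nat[of i n p] by simp
        then show False using that by simp
      qed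
      then show ?thesis by (auto simp: A_def E_def)
    qed
    have "fps_nth (A * E) n = fps_nth A (n mod p) * fps_nth E (n - n mod p)
        + (\<Sum>i\<in>{0..n} - {n mod p}. fps_nth A i * fps_nth E (n - i))"
      unfolding fps_mult_nth by (rule sum.remove) auto
    also have "(\<Sum>i\<in>{0..n} - {n mod p}. fps_nth A i * fps_nth E (n - i)) = 0"
      using zero by (intro sum.neutral) blast
    also have "fps_nth A (n mod p) * fps_nth E (n - n mod p)
        = fps_nth G (n mod p) * fps_nth G (n div p)"
      using \<open>p > 0\<close> by (simp add: A_def E_def minus_mod_eq_mult_div)
    finally show ?thesis by simp
  qed
  define D where "D = G - A * E"
  have D: "fps_const (int p) dvd D"
  proof (unfold fps_const_dvd_iff, safe)
    fix n
    have "[fps_nth G n = fps_nth G (n div p) * fps_nth G (n mod p)] (mod int p)"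
      using lucas[of "n mod p" "n div p"] \<open>p > 0\<close> by simp
    then show "int p dvd fps_nth D n"
      by (simp add: D_def AE cong_iff_dvd_diff mult.commute)
  qed
  have D': "fps_const (int p) dvd fps_deriv D"
    using D by (auto elim!: dvdE)
  have E': "fps_const (int p) dvd fps_deriv E"
    by (auto simp: fps_const_dvd_iff E_def simp flip: of_nat_Suc)
  have G: "G = A * E + D" by (simp add: D_def)
  have "fps_deriv G * A - G * fps_deriv A
      = A * A * fps_deriv E + fps_deriv D * A - D * fps_deriv A"
    unfolding G by (simp add: algebra_simps)
  also have "fps_const (int p) dvd \<dots>"
    using D D' E' by simp
  finally show ?thesis .
qed

text \<open>The denominator is the truncation \<open>v\<close> of \<open>G\<close>, and the numerator its derivative; \<open>G\<close>
  itself can be cancelled modulo \<open>p\<close> because its constant term is \<open>1\<close>.\<close>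
lemma lucas_log_deriv_rational_mod:
  fixes G f :: "int fps" and p :: nat
  assumes p: "prime p" and G0: "fps_nth G 0 = 1"
    and lucas: "\<And>n r. r < p \<Longrightarrow>
      [fps_nth G (n * p + r) = fps_nth G n * fps_nth G r] (mod int p)"
    and f: "f * G = fps_deriv G"
  shows "\<exists>v. \<not> [:int p:] dvd v \<and> polynomial_mod (int p) (fps_of_poly v * f)"
proof -
  have q: "prime_elem (int p)" using p by simp
  define v where "v = truncate_fps p G"
  have "coeff v 0 = 1"
    using G0 p fps_of_poly_nth[of v 0] by (simp add: v_def prime_gt_0_nat)
  then have nv: "\<not> [:int p:] dvd v"
    using p by (auto simp: const_poly_dvd_iff dest!: spec[of _ 0] intro!: exI[of _ 0])
  have "fps_const (int p) dvd G * (fps_of_poly v * f - fps_of_poly (pderiv v))"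
    using lucas_log_deriv_mod[OF p lucas]
    by (simp add: v_def f[symmetric] fps_of_poly_pderiv algebra_simps)
  moreover have "\<not> fps_const (int p) dvd G"
    using G0 p by (auto simp: fps_const_dvd_iff intro!: exI[of _ 0])
  ultimately have "fps_const (int p) dvd fps_of_poly v * f - fps_of_poly (pderiv v)"
    using fps_const_prime_dvd_mult[OF q] by blast
  then show ?thesis using nv unfolding polynomial_mod_def by blast
qed

section \<open>From Laurent series over the rationals to integer power series\<close>

lemma fls_of_int_fps_eq_iff [simp]: "fls_of_int_fps f = fls_of_int_fps g \<longleftrightarrow> f = g"
  by (simp add: fls_of_int_fps_def fps_eq_iff)

lemma fls_of_int_fps_0 [simp]: "fls_of_int_fps 0 = 0"
  and fls_of_int_fps_1 [simp]: "fls_of_int_fps 1 = 1"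
  by (simp_all add: fls_of_int_fps_def fps_eq_iff)

lemma fls_of_int_fps_add: "fls_of_int_fps (f + g) = fls_of_int_fps f + fls_of_int_fps g"
  by (simp add: fls_of_int_fps_def fps_eq_iff flip: fps_to_fls_plus)

lemma fls_of_int_fps_mult: "fls_of_int_fps (f * g) = fls_of_int_fps f * fls_of_int_fps g"
  by (simp add: fls_of_int_fps_def fps_eq_iff fps_mult_nth flip: fls_times_fps_to_fls)

lemma fls_of_int_fps_power: "fls_of_int_fps (f ^ n) = fls_of_int_fps f ^ n"
  by (induction n) (simp_all add: fls_of_int_fps_mult)

lemma fls_of_int_fps_sum: "fls_of_int_fps (sum f A) = (\<Sum>x\<in>A. fls_of_int_fps (f x))"
  by (induction A rule: infinite_finite_induct) (simp_all add: fls_of_int_fps_add)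

lemma fls_of_int_fps_deriv: "fls_of_int_fps (fps_deriv f) = fls_deriv (fls_of_int_fps f)"
  by (simp add: fls_of_int_fps_def fls_deriv_fps_to_fls fps_eq_iff)

lemma fls_of_int_fps_of_poly:
  "fls_of_int_fps (fps_of_poly p) = fps_to_fls (fps_of_poly (map_poly rat_of_int p))"
  by (simp add: fls_of_int_fps_def fps_eq_iff coeff_map_poly)

lemma fls_of_int_fps_of_poly_eq_0_iff [simp]: "fls_of_int_fps (fps_of_poly p) = 0 \<longleftrightarrow> p = 0"
  using fls_of_int_fps_eq_iff[of "fps_of_poly p" 0] fps_of_poly_eq_iff[of p 0] by simp

lemma rat_poly_clear_denominators:
  "\<exists>m s. m \<noteq> 0 \<and> smult (rat_of_int m) p = map_poly rat_of_int s"
proof (induction p)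
  case 0
  show ?case by (rule exI[of _ 1], rule exI[of _ 0]) simp
next
  case (pCons a p)
  then obtain m s where m: "m \<noteq> 0" "smult (rat_of_int m) p = map_poly rat_of_int s" by blast
  obtain k l where kl: "a = rat_of_int k / rat_of_int l" "l \<noteq> 0"
    by (cases a) (auto simp: Fract_of_int_quotient)
  have "smult (rat_of_int (l * m)) (pCons a p)
      = pCons (rat_of_int (m * k)) (smult (rat_of_int l) (map_poly rat_of_int s))"
    using kl(2) m(2) by (simp add: kl(1) flip: smult_smult)
  also have "\<dots> = map_poly rat_of_int (pCons (m * k) (smult l s))"
    by (simp add: map_poly_pCons map_poly_smult)
  finally show ?case using m(1) kl(2)
    by (intro exI[of _ "l * m"] exI[of _ "pCons (m * k) (smult l s)"]) simp
qed

lemma rational_functions_int_iff: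
  "x \<in> rational_functions \<longleftrightarrow>
    (\<exists>s t. t \<noteq> 0 \<and> fls_of_int_fps (fps_of_poly t) * x = fls_of_int_fps (fps_of_poly s))"
proof
  assume "x \<in> rational_functions"
  then obtain p q where q: "q \<noteq> 0"
    and x: "x = fps_to_fls (fps_of_poly p) / fps_to_fls (fps_of_poly q)"
    unfolding rational_functions_def by blast
  obtain m s where m: "m \<noteq> 0" "smult (rat_of_int m) p = map_poly rat_of_int s"
    using rat_poly_clear_denominators by blast
  obtain k t where k: "k \<noteq> 0" "smult (rat_of_int k) q = map_poly rat_of_int t"
    using rat_poly_clear_denominators by blast
  have "smult m t \<noteq> 0" using k q m(1) by auto
  moreover have "smult (rat_of_int m) (map_poly rat_of_int t) * p
      = smult (rat_of_int k) (map_poly rat_of_int s) * q"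
    by (simp add: mult_ac flip: m(2) k(2))
  then have "fls_of_int_fps (fps_of_poly (smult m t)) * fps_to_fls (fps_of_poly p)
      = fls_of_int_fps (fps_of_poly (smult k s)) * fps_to_fls (fps_of_poly q)"
    by (simp add: fls_of_int_fps_of_poly map_poly_smult
        flip: fls_times_fps_to_fls fps_of_poly_mult)
  then have "fls_of_int_fps (fps_of_poly (smult m t)) * x
      = fls_of_int_fps (fps_of_poly (smult k s))"
    using q fps_of_poly_eq_iff[of q 0] by (simp add: x)
  ultimately show "\<exists>s t. t \<noteq> 0 \<and>
      fls_of_int_fps (fps_of_poly t) * x = fls_of_int_fps (fps_of_poly s)" by blast
next
  assume "\<exists>s t. t \<noteq> 0 \<and> fls_of_int_fps (fps_of_poly t) * x = fls_of_int_fps (fps_of_poly s)"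
  then obtain s t where t: "t \<noteq> 0"
    and eq: "fls_of_int_fps (fps_of_poly t) * x = fls_of_int_fps (fps_of_poly s)" by blast
  have "x = fls_of_int_fps (fps_of_poly s) / fls_of_int_fps (fps_of_poly t)"
    using t by (simp add: eq[symmetric])
  moreover have "map_poly rat_of_int t \<noteq> 0" using t by (simp add: map_poly_eq_0_iff)
  ultimately show "x \<in> rational_functions"
    unfolding rational_functions_def fls_of_int_fps_of_poly by blast
qed

text \<open>All coefficients of an annihilating polynomial are multiplied by the product \<open>D\<close> of their
  denominators, after which the relation can be pulled back along the injective ring
  homomorphism from integer power series to Laurent series.\<close>
lemma algebraic_over_rational_functions_int_relation:
  assumes "algebraic_over rational_functions (fls_of_int_fps f)"
  obtains d c where "c d \<noteq> 0" "(\<Sum>i\<le>d. fps_of_poly (c i) * f ^ i) = 0"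
proof -
  let ?\<iota> = "\<lambda>p. fls_of_int_fps (fps_of_poly p)"
  from assms obtain P where P: "\<And>i. coeff P i \<in> rational_functions" "P \<noteq> 0"
    "poly P (fls_of_int_fps f) = 0"
    unfolding algebraic_over_def by blast
  define d where "d = degree P"
  obtain s t where t: "\<And>i. t i \<noteq> 0" and st: "\<And>i. ?\<iota> (t i) * coeff P i = ?\<iota> (s i)"
    using P(1) unfolding rational_functions_int_iff by metis
  define D where "D = (\<Prod>i\<le>d. t i)"
  define c where "c i = s i * (\<Prod>j\<in>{..d} - {i}. t j)" for i
  have c: "?\<iota> (c i) = ?\<iota> D * coeff P i" if "i \<le> d" for i
    using that by (simp add: c_def D_def prod.remove[of "{..d}" i] fps_of_poly_mult
        fls_of_int_fps_mult mult_ac flip: st)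
  have "?\<iota> (c d) \<noteq> 0"
    using P(2) t by (simp add: c D_def) (simp add: d_def)
  then have "c d \<noteq> 0" by auto
  moreover have "fls_of_int_fps (\<Sum>i\<le>d. fps_of_poly (c i) * f ^ i)
      = ?\<iota> D * poly P (fls_of_int_fps f)"
    by (simp add: poly_altdef d_def[symmetric] fls_of_int_fps_sum fls_of_int_fps_mult
        fls_of_int_fps_power c sum_distrib_left mult.assoc)
  then have "(\<Sum>i\<le>d. fps_of_poly (c i) * f ^ i) = 0"
    using P(3) fls_of_int_fps_eq_iff[of _ 0] by simp
  ultimately show ?thesis by (rule that)
qed

lemma int_eq_0_if_large_primes_dvd:
  fixes z :: int
  assumes "\<And>p. prime p \<Longrightarrow> p > N \<Longrightarrow> int p dvd z"
  shows "z = 0"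
proof (rule ccontr)
  assume "z \<noteq> 0"
  obtain p where p: "prime p" "p > N + nat \<bar>z\<bar>" using bigger_prime by blast
  then have "int p dvd z" using assms by simp
  then have "int p \<le> \<bar>z\<bar>" using \<open>z \<noteq> 0\<close> by (simp add: zdvd_imp_le)
  then show False using p by simp
qed

section \<open>Rationality of the logarithmic derivative\<close>

theorem mainTheorem10:
  fixes G :: "int fps"
  assumes "fps_nth G 0 = 1"
    and "lucas_property (fps_nth G)"
    and "algebraic_over rational_functions (fls_deriv (fls_of_int_fps G) / fls_of_int_fps G)"
  shows "fls_deriv (fls_of_int_fps G) / fls_of_int_fps G \<in> rational_functions"
proof -
  define f where "f = fps_deriv G * fps_right_inverse G 1"
  have fG: "f * G = fps_deriv G"
    using fps_right_inverse[of G 1] assms(1) by (simp add: f_def mult_ac)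
  have "G \<noteq> 0" using assms(1) by auto
  then have "fls_of_int_fps G \<noteq> 0"
    using fls_of_int_fps_eq_iff[of G 0] by simp
  then have quot: "fls_deriv (fls_of_int_fps G) / fls_of_int_fps G = fls_of_int_fps f"
    by (simp add: fls_of_int_fps_mult flip: fls_of_int_fps_deriv fG)
  obtain N where N: "\<And>p n r. prime p \<Longrightarrow> p > N \<Longrightarrow> r < p \<Longrightarrow>
      [fps_nth G (n * p + r) = fps_nth G n * fps_nth G r] (mod int p)"
    using assms(2) unfolding lucas_property_def by blast
  obtain d c where cd: "c d \<noteq> 0" and c: "(\<Sum>i\<le>d. fps_of_poly (c i) * f ^ i) = 0"
    using assms(3) algebraic_over_rational_functions_int_relation unfolding quot by blast
  define h where "h = fps_of_poly (c d) * f"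
  define b where "b j = - (c j * c d ^ (d - Suc j))" for j
  have rel: "h ^ d = (\<Sum>j<d. fps_of_poly (b j) * h ^ j)"
    unfolding h_def b_def by (rule integral_leading_coeff_mult[OF c cd])
  \<comment> \<open>Any common bound of the degrees will do, as long as it does not depend on the prime.\<close>
  define B where "B = (\<Sum>j<d. degree (b j))"
  have B: "degree (b j) \<le> B" if "j < d" for j
    unfolding B_def using that by (intro member_le_sum) auto
  have dvd: "int p dvd fps_nth h n" if p: "prime p" "p > N" and n: "n > B" for p n
  proof -
    obtain v where v: "\<not> [:int p:] dvd v" "polynomial_mod (int p) (fps_of_poly v * f)"
      using lucas_log_deriv_rational_mod[OF p(1) assms(1) N[OF p] fG] by blast
    have "polynomial_mod (int p) (fps_of_poly v * h)"
      using polynomial_mod_mult[OF polynomial_mod_fps_of_poly[of _ "c d"] v(2)]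
      by (simp add: h_def mult_ac)
    with p v(1) show ?thesis
      by (intro integral_rational_mod_degree_bound[OF _ rel B _ _ n]) simp_all
  qed
  have zero: "fps_nth h n = 0" if "n > B" for n
    using dvd[OF _ _ that] by (rule int_eq_0_if_large_primes_dvd)
  define H where "H = truncate_fps (Suc B) h"
  have "fps_of_poly H = h"
    using zero by (auto simp: H_def fps_eq_iff not_less)
  then have "fls_of_int_fps (fps_of_poly (c d)) * fls_of_int_fps f = fls_of_int_fps (fps_of_poly H)"
    by (simp add: h_def fls_of_int_fps_mult)
  then show ?thesis
    unfolding quot rational_functions_int_iff using cd by blast
qed

end
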